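(* Let $(\mathfrak g,\omega)$ be an odd-symplectic Lie superalgebra, let $|e|\in\mathbb Z_2$, let $D$ be a homogeneous superderivation of $\mathfrak g$ of degree $|e|$ and let $x_0\in\mathfrak g_{\bar 0}$ be such that $$(1-(-1)^{|e|})\Bigl(D^2-\tfrac12[x_0,\cdot]\Bigr)=0\quad\text{and}\quad(1-(-1)^{|e|})D(x_0)=0.$$ Consider the scalar 2-cocycle $\theta$ of $\mathfrak g$ defined, for homogeneous $X$ and all $Y$ in $\mathfrak g$, by $$\theta(X,Y)=\omega\Bigl(\Bigl[D^*\bigl((-1)^{|e||x|}D+D^*\bigr)+\bigl(D+(-1)^{|e|(|x|+1)}D^*\bigr)D\Bigr](X),Y\Bigr),$$ where $D^*$ is the adjoint of $D$ with respect to $\omega$. Suppose that $\theta$ is a 2-coboundary, i.e. there exists $b_0\in\mathfrak g_{\bar 0}$ with $\theta(X,Y)=\omega(b_0,[X,Y])$ for all $X,Y\in\mathfrak g$; this is automatically the case, with $b_0=\frac12x_0$, if $D$ is odd, and in that case one takes $b_0=\frac12x_0$. Then: (1) The linear map $\widetilde D$ on the Lie superalgebra $P(\mathbb Ke^* )\oplus\mathfrak g$ (the central extension of $\mathfrak g$ by means of $\gamma$) defined by $$\widetilde D(ae^*+X)=D(X)-\omega(b_0,X)e^*$$ is a homogeneous superderivation of degree $|e|$. (2) The $\mathbb Z_2$-graded vector space $\mathfrak t=P(\mathbb Ke^* )\oplus\mathfrak g\oplus\mathbb Ke$, endowed with the bracket determined by $$[e,e]=\tfrac12(1-(-1)^{|e|})x_0,\qquad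 [e,X]=\widetilde D(X),\qquad [X,Y]=[X,Y]_{\mathfrak g}+\gamma(X,Y)e^*\qquad (X,Y\in\mathfrak g),$$ with $e^*$ central, is a Lie superalgebra. (3) The skew-supersymmetric bilinear form $\Omega$ on $\mathfrak t$ defined by $\Omega|_{\mathfrak g\times\mathfrak g}=\omega$, $\Omega(e^*,e)=1$, and $\Omega$ null elsewhere (apart from $\Omega(e,e^* )$, which is given by skew-supersymmetry), is an odd-symplectic form on $\mathfrak t$; thus $(\mathfrak t,\Omega)$ is an odd-symplectic Lie superalgebra.
   Context: All Lie superalgebras are finite dimensional over an algebraically closed field $\mathbb K$ of characteristic zero; $|x|\in\mathbb Z_2$ is the degree of a homogeneous $X$. A bilinear form $\theta$ on $\mathfrak g$ is odd if $\theta(\mathfrak g_\alpha,\mathfrak g_\alpha)=\{0\}$ for all $\alpha\in\mathbb Z_2$, and skew-supersymmetric if $\theta(X,Y)=-(-1)^{|x||y|}\theta(Y,X)$ for homogeneous $X,Y$. A homogeneous scalar 2-cocycle is a homogeneous skew-supersymmetric bilinear form $\omega$ with $(-1)^{|z||x|}\omega(X,[Y,Z])+(-1)^{|x||y|}\omega(Y,[Z,X])+(-1)^{|y||z|}\omega(Z,[X,Y])=0$ for homogeneous $X,Y,Z$. An odd-symplectic form is an odd non-degenerate scalar 2-cocycle; $(\mathfrak g,\omega)$ is then called an odd-symplectic Lie superalgebra. A homogeneous superderivation of degree $d$ is a linear map $D$ with $D(\mathfrak g_\alpha)\subseteq\mathfrak g_{\alpha+d}$ and $D[X,Y]=[D(X),Y]+(-1)^{d|x|}[X,D(Y)]$.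 The adjoint $D^*$ of $D$ is the linear map with $\omega(D^*(X),Y)=\omega(X,D(Y))$ for all $X,Y\in\mathfrak g$. $\mathbb Ke$ is a one-dimensional $\mathbb Z_2$-graded space spanned by $e$ of degree $|e|$, and $P(\mathbb Ke^* )=\mathbb Ke^*$ is its dual with shifted parity, so that $e^*$ has degree $|e|+\bar 1$. The bilinear form $\gamma$ on $\mathfrak g$ is given by $$\gamma(X,Y)=-\bigl[\omega(D(X),Y)+(-1)^{|e||x|}\omega(X,D(Y))\bigr],$$ and the central extension $P(\mathbb Ke^* )\oplus\mathfrak g$ of $\mathfrak g$ by means of $\gamma$ is the Lie superalgebra with bracket $[ae^*+X,be^*+Y]=\gamma(X,Y)e^*+[X,Y]_{\mathfrak g}$. *)

theory Defs
  imports
    "HOL-Computational_Algebra.Polynomial"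
    "HOL-Library.Z2"
    "HOL-Analysis.Product_Vector"
begin

section \<open>Superspaces and Lie superalgebras\<close>

text \<open>
  Degrees live in \<^typ>\<open>bit\<close>, the field with two elements, so that sums and products of degrees
  are taken in it; \<open>ssign a\<close> is the sign \<open>(-1)\<^sup>a\<close>. A superspace is a whole type carrying a
  vector space structure \<open>scl\<close>, with homogeneous parts \<open>gr 0\<close> and \<open>gr 1\<close>.
\<close>

definition ssign :: "bit \<Rightarrow> 'k::ring_1" where
  "ssign a = (if a = 0 then 1 else - 1)"

definition bilinear_map ::
  "('k::field \<Rightarrow> 'v::ab_group_add \<Rightarrow> 'v) \<Rightarrow> ('k \<Rightarrow> 'w::ab_group_add \<Rightarrow> 'w) \<Rightarrow> ('v \<Rightarrow> 'v \<Rightarrow> 'w) \<Rightarrow> bool"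
where
  "bilinear_map s t f \<longleftrightarrow>
     (\<forall>x. Vector_Spaces.linear s t (\<lambda>y. f x y)) \<and> (\<forall>y. Vector_Spaces.linear s t (\<lambda>x. f x y))"

locale super_vector_space = vector_space scl
  for scl :: "'k::{alg_closed_field, field_char_0} \<Rightarrow> 'v::ab_group_add \<Rightarrow> 'v" +
  fixes gr :: "bit \<Rightarrow> 'v set"
  assumes finite_dimensional: "\<exists>B. finite B \<and> span B = UNIV"
    and subspace_gr: "subspace (gr a)"
    and gr_Int: "gr 0 \<inter> gr 1 = {0}"
    and gr_sum: "\<exists>y\<in>gr 0. \<exists>z\<in>gr 1. x = y + z"

locale lie_superalgebra = super_vector_space scl gr
  for scl :: "'k::{alg_closed_field, field_char_0} \<Rightarrow> 'v::ab_group_add \<Rightarrow> 'v"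
    and gr :: "bit \<Rightarrow> 'v set" +
  fixes br :: "'v \<Rightarrow> 'v \<Rightarrow> 'v"
  assumes bilinear_br: "bilinear_map scl scl br"
    and br_gr: "X \<in> gr a \<Longrightarrow> Y \<in> gr b \<Longrightarrow> br X Y \<in> gr (a + b)"
    and br_skew: "X \<in> gr a \<Longrightarrow> Y \<in> gr b \<Longrightarrow> br X Y = - scl (ssign (a * b)) (br Y X)"
    and br_jacobi: "X \<in> gr a \<Longrightarrow> Y \<in> gr b \<Longrightarrow> Z \<in> gr c \<Longrightarrow>
      scl (ssign (c * a)) (br X (br Y Z)) + scl (ssign (a * b)) (br Y (br Z X))
        + scl (ssign (b * c)) (br Z (br X Y)) = 0"

definition superderivation ::
  "('k::field \<Rightarrow> 'v::ab_group_add \<Rightarrow> 'v) \<Rightarrow> (bit \<Rightarrow> 'v set) \<Rightarrow> ('v \<Rightarrow> 'v \<Rightarrow> 'v) \<Rightarrow> bit \<Rightarrow> ('v \<Rightarrow> 'v) \<Rightarrow> bool"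
where
  "superderivation scl gr br d D \<longleftrightarrow>
     Vector_Spaces.linear scl scl D \<and>
     (\<forall>a. \<forall>X\<in>gr a. D X \<in> gr (a + d)) \<and>
     (\<forall>a. \<forall>X\<in>gr a. \<forall>Y. D (br X Y) = br (D X) Y + scl (ssign (d * a)) (br X (D Y)))"


section \<open>Bilinear forms and odd-symplectic structures\<close>

definition homogeneous_form :: "(bit \<Rightarrow> 'v set) \<Rightarrow> bit \<Rightarrow> ('v \<Rightarrow> 'v \<Rightarrow> 'k::zero) \<Rightarrow> bool" where
  "homogeneous_form gr d \<theta> \<longleftrightarrow>
     (\<forall>a b. a + b \<noteq> d \<longrightarrow> (\<forall>X\<in>gr a. \<forall>Y\<in>gr b. \<theta> X Y = 0))"

definition odd_form :: "(bit \<Rightarrow> 'v set) \<Rightarrow> ('v \<Rightarrow> 'v \<Rightarrow> 'k::zero) \<Rightarrow> bool" where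
  "odd_form gr \<theta> \<longleftrightarrow> (\<forall>a. \<forall>X\<in>gr a. \<forall>Y\<in>gr a. \<theta> X Y = 0)"

definition skew_supersymmetric :: "(bit \<Rightarrow> 'v set) \<Rightarrow> ('v \<Rightarrow> 'v \<Rightarrow> 'k::ring_1) \<Rightarrow> bool" where
  "skew_supersymmetric gr \<theta> \<longleftrightarrow>
     (\<forall>a b. \<forall>X\<in>gr a. \<forall>Y\<in>gr b. \<theta> X Y = - ssign (a * b) * \<theta> Y X)"

definition nondegenerate_form :: "('v::zero \<Rightarrow> 'v \<Rightarrow> 'k::zero) \<Rightarrow> bool" where
  "nondegenerate_form \<theta> \<longleftrightarrow>
     (\<forall>X. (\<forall>Y. \<theta> X Y = 0) \<longrightarrow> X = 0) \<and> (\<forall>Y. (\<forall>X. \<theta> X Y = 0) \<longrightarrow> Y = 0)"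

definition scalar_2_cocycle ::
  "('k::field \<Rightarrow> 'v::ab_group_add \<Rightarrow> 'v) \<Rightarrow> (bit \<Rightarrow> 'v set) \<Rightarrow> ('v \<Rightarrow> 'v \<Rightarrow> 'v) \<Rightarrow> ('v \<Rightarrow> 'v \<Rightarrow> 'k) \<Rightarrow> bool"
where
  "scalar_2_cocycle scl gr br \<omega> \<longleftrightarrow>
     bilinear_map scl (*) \<omega> \<and>
     (\<exists>d. homogeneous_form gr d \<omega>) \<and>
     skew_supersymmetric gr \<omega> \<and>
     (\<forall>a b c. \<forall>X\<in>gr a. \<forall>Y\<in>gr b. \<forall>Z\<in>gr c.
        ssign (c * a) * \<omega> X (br Y Z) + ssign (a * b) * \<omega> Y (br Z X)
          + ssign (b * c) * \<omega> Z (br X Y) = 0)"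

locale odd_symplectic_lie_superalgebra = lie_superalgebra scl gr br
  for scl :: "'k::{alg_closed_field, field_char_0} \<Rightarrow> 'v::ab_group_add \<Rightarrow> 'v"
    and gr :: "bit \<Rightarrow> 'v set" and br :: "'v \<Rightarrow> 'v \<Rightarrow> 'v" +
  fixes \<omega> :: "'v \<Rightarrow> 'v \<Rightarrow> 'k"
  assumes cocycle: "scalar_2_cocycle scl gr br \<omega>"
    and odd: "odd_form gr \<omega>"
    and nondegenerate: "nondegenerate_form \<omega>"

definition form_adjoint ::
  "('k::field \<Rightarrow> 'v::ab_group_add \<Rightarrow> 'v) \<Rightarrow> ('v \<Rightarrow> 'v \<Rightarrow> 'k) \<Rightarrow> ('v \<Rightarrow> 'v) \<Rightarrow> 'v \<Rightarrow> 'v"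
where
  "form_adjoint scl \<omega> D =
     (THE D'. Vector_Spaces.linear scl scl D' \<and> (\<forall>X Y. \<omega> (D' X) Y = \<omega> X (D Y)))"


section \<open>The double extension\<close>

text \<open>
  Formulas that the mathematics states for homogeneous \<open>X\<close> only are extended linearly to all
  \<open>X\<close>. Here \<open>hcomp gr a X\<close> is the component of \<open>X\<close> of degree \<open>a\<close>, and \<open>twist\<close> is the linear
  map with \<open>X \<mapsto> (-1)\<^bsup>d |X|\<^esup> X\<close> on homogeneous \<open>X\<close>.
\<close>

definition hcomp :: "(bit \<Rightarrow> 'v::ab_group_add set) \<Rightarrow> bit \<Rightarrow> 'v \<Rightarrow> 'v" where
  "hcomp gr a X = (THE Y. Y \<in> gr a \<and> X - Y \<in> gr (a + 1))"

definition twist ::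
  "('k::field \<Rightarrow> 'v::ab_group_add \<Rightarrow> 'v) \<Rightarrow> (bit \<Rightarrow> 'v set) \<Rightarrow> bit \<Rightarrow> 'v \<Rightarrow> 'v"
where
  "twist scl gr d X = (\<Sum>a\<in>{0, 1}. scl (ssign (d * a)) (hcomp gr a X))"

definition theta_form ::
  "('k::field \<Rightarrow> 'v::ab_group_add \<Rightarrow> 'v) \<Rightarrow> (bit \<Rightarrow> 'v set) \<Rightarrow> ('v \<Rightarrow> 'v \<Rightarrow> 'k) \<Rightarrow> bit \<Rightarrow> ('v \<Rightarrow> 'v)
    \<Rightarrow> 'v \<Rightarrow> 'v \<Rightarrow> 'k"
where
  "theta_form scl gr \<omega> e D X Y =
     (let D' = form_adjoint scl \<omega> D in
      \<Sum>a\<in>{0, 1}. let Z = hcomp gr a X in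
        \<omega> (D' (scl (ssign (e * a)) (D Z) + D' Z)
             + (D (D Z) + scl (ssign (e * (a + 1))) (D' (D Z)))) Y)"

definition gamma_form ::
  "('k::field \<Rightarrow> 'v::ab_group_add \<Rightarrow> 'v) \<Rightarrow> (bit \<Rightarrow> 'v set) \<Rightarrow> ('v \<Rightarrow> 'v \<Rightarrow> 'k) \<Rightarrow> bit \<Rightarrow> ('v \<Rightarrow> 'v)
    \<Rightarrow> 'v \<Rightarrow> 'v \<Rightarrow> 'k"
where
  "gamma_form scl gr \<omega> e D X Y = - (\<omega> (D X) Y + \<omega> (twist scl gr e X) (D Y))"

text \<open>
  The pair \<open>(a, X)\<close> stands for \<open>a e\<^sup>* + X\<close>, with \<open>e\<^sup>*\<close> of degree \<open>e + 1\<close>, where \<open>e\<close> denotes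
  the degree of the basis vector \<open>e\<close>.
\<close>

definition ext_scale ::
  "('k::field \<Rightarrow> 'v::ab_group_add \<Rightarrow> 'v) \<Rightarrow> 'k \<Rightarrow> 'k \<times> 'v \<Rightarrow> 'k \<times> 'v"
where
  "ext_scale scl = module_prod.scale (*) scl"

definition ext_gr :: "(bit \<Rightarrow> 'v set) \<Rightarrow> bit \<Rightarrow> bit \<Rightarrow> ('k::zero \<times> 'v) set" where
  "ext_gr gr e c = {(a, X). X \<in> gr c \<and> (a = 0 \<or> c = e + 1)}"

definition ext_br :: "('v \<Rightarrow> 'v \<Rightarrow> 'v) \<Rightarrow> ('v \<Rightarrow> 'v \<Rightarrow> 'k) \<Rightarrow> 'k \<times> 'v \<Rightarrow> 'k \<times> 'v \<Rightarrow> 'k \<times> 'v" where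
  "ext_br br \<gamma> = (\<lambda>(a, X) (b, Y). (\<gamma> X Y, br X Y))"

definition ext_der ::
  "('v \<Rightarrow> 'v \<Rightarrow> 'k::ring_1) \<Rightarrow> ('v \<Rightarrow> 'v) \<Rightarrow> 'v \<Rightarrow> 'k \<times> 'v \<Rightarrow> 'k \<times> 'v"
where
  "ext_der \<omega> D b0 = (\<lambda>(a, X). (- \<omega> b0 X, D X))"

text \<open>
  The pair \<open>((a, X), s)\<close> stands for \<open>a e\<^sup>* + X + s e\<close>. In \<open>dext_br\<close> the summand with
  coefficient \<open>t\<close> is \<open>[X, e] = -(-1)\<^bsup>e |X|\<^esup> [e, X]\<close>, as forced by skew-supersymmetry.
\<close>

definition dext_scale ::
  "('k::field \<Rightarrow> 'v::ab_group_add \<Rightarrow> 'v) \<Rightarrow> 'k \<Rightarrow> ('k \<times> 'v) \<times> 'k \<Rightarrow> ('k \<times> 'v) \<times> 'k"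
where
  "dext_scale scl = module_prod.scale (ext_scale scl) (*)"

definition dext_gr :: "(bit \<Rightarrow> 'v set) \<Rightarrow> bit \<Rightarrow> bit \<Rightarrow> (('k::zero \<times> 'v) \<times> 'k) set" where
  "dext_gr gr e c = {(u, s). u \<in> ext_gr gr e c \<and> (s = 0 \<or> c = e)}"

definition dext_br ::
  "('k::field \<Rightarrow> 'v::ab_group_add \<Rightarrow> 'v) \<Rightarrow> (bit \<Rightarrow> 'v set) \<Rightarrow> ('v \<Rightarrow> 'v \<Rightarrow> 'v) \<Rightarrow> ('v \<Rightarrow> 'v \<Rightarrow> 'k)
    \<Rightarrow> bit \<Rightarrow> ('v \<Rightarrow> 'v) \<Rightarrow> 'v \<Rightarrow> 'v \<Rightarrow> ('k \<times> 'v) \<times> 'k \<Rightarrow> ('k \<times> 'v) \<times> 'k \<Rightarrow> ('k \<times> 'v) \<times> 'k"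
where
  "dext_br scl gr br \<omega> e D x0 b0 = (\<lambda>((a, X), s) ((b, Y), t).
     (ext_br br (gamma_form scl gr \<omega> e D) (a, X) (b, Y)
        + ext_scale scl s (ext_der \<omega> D b0 (b, Y))
        - ext_scale scl t (ext_der \<omega> D b0 (0, twist scl gr e X))
        + (0, scl (s * t * ((1 / 2) * (1 - ssign e))) x0),
      0))"

definition dext_form ::
  "('v \<Rightarrow> 'v \<Rightarrow> 'k::field) \<Rightarrow> bit \<Rightarrow> ('k \<times> 'v) \<times> 'k \<Rightarrow> ('k \<times> 'v) \<times> 'k \<Rightarrow> 'k"
where
  "dext_form \<omega> e = (\<lambda>((a, X), s) ((b, Y), t).
     \<omega> X Y + a * t - ssign (e * (e + 1)) * (s * b))"

end

theory Submission
  imports Defs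
begin

text \<open>
  For a homogeneous superderivation \<open>D\<close> of degree \<open>d\<close>, the Lie derivative
  \<open>(L\<^sub>D f)(X, Y) = f (D X, Y) + (-1)\<^bsup>d |X|\<^esup> f (X, D Y)\<close>
  sends scalar 2-cocycles to scalar 2-cocycles (\<open>cocycle_lie_derivative\<close>): up to signs, the cocycle
  identity of \<open>L\<^sub>D f\<close> at \<open>(X, Y, Z)\<close> is the sum of those of \<open>f\<close> at \<open>(D X, Y, Z)\<close>, \<open>(X, D Y, Z)\<close>
  and \<open>(X, Y, D Z)\<close>. Both forms of the theorem arise in this way: \<open>\<gamma> = - L\<^sub>D \<omega>\<close> and, once the
  adjoint of \<open>D\<close> has been moved to the other argument of \<open>\<omega>\<close>, \<open>\<theta> = L\<^sub>D (L\<^sub>D \<omega>)\<close>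
  (\<open>theta_form_eq\<close>). Hence both are cocycles, and \<open>\<theta> = - L\<^sub>D \<gamma>\<close> measures how far \<open>D\<close> is from being a
  derivation of the central extension by \<open>\<gamma>\<close>: a primitive \<open>b0\<close> of \<open>\<theta>\<close> is exactly what is needed
  to correct \<open>D\<close> by the \<open>e\<^sup>*\<close>-component \<open>- \<omega>(b0, X)\<close> (\<open>superderivation_ext_der\<close>).

  The double extension is then built from two general constructions: the central extension by a
  cocycle (\<open>lie_superalgebra_central_extension\<close>), and the extension of a Lie superalgebra by one more
  generator \<open>e\<close> that acts by a superderivation \<open>\<delta>\<close> and has square \<open>[e, e] = h0\<close>
  (\<open>lie_superalgebra_derivation_extension\<close>). The latter needs \<open>\<delta> h0 = 0\<close> and, for odd \<open>e\<close>,
  \<open>2 \<delta>\<^sup>2 = [h0, _]\<close>, while \<open>h0 = 0\<close> for even \<open>e\<close>. Here \<open>\<delta>\<close> is the corrected \<open>D\<close>,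
  and these conditions follow from the hypotheses relating \<open>D\<close> to \<open>x0\<close>; in the \<open>e\<^sup>*\<close>-component of the
  second one it matters that \<open>b0 = x0 / 2\<close>. Finally the cocycle
  identity for the extended form reduces to that of \<open>\<omega>\<close>: the terms that involve \<open>e\<close> once cancel by
  the definition of \<open>\<gamma>\<close>, and those that involve \<open>e\<close> twice cancel in pairs for even \<open>e\<close> and by
  \<open>b0 = x0 / 2\<close> for odd \<open>e\<close>.

  Since \<open>\<omega>\<close> is odd, it pairs only elements \<open>X\<close>, \<open>Y\<close> of different degree, for
  which \<open>(-1)\<^bsup>|X| |Y|\<^esup> = 1\<close>; thus \<open>\<omega>\<close> is skew-symmetric on all of \<open>\<gg>\<close>. All sign computations
  below are settled by running through the degrees in \<open>{0, 1}\<close>, with the pairings that vanish for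
  degree reasons supplied.
\<close>

text \<open>Degrees are added and multiplied as field elements; rewriting these operations into bitwise
  ones would hide the arithmetic.\<close>

declare add_bit_eq_xor [simp del] mult_bit_eq_and [simp del]

section \<open>Signs and bilinear maps\<close>

lemma ssign_simps [simp]: "ssign 0 = 1" "ssign 1 = - 1"
  by (simp_all add: ssign_def)

lemma vector_space_field: "vector_space ((*) :: 'k::field \<Rightarrow> 'k \<Rightarrow> 'k)"
  by unfold_locales (simp_all add: algebra_simps)

lemma bilinear_mapI:
  assumes "vector_space s" "vector_space t"
    and "\<And>x y z. f (x + y) z = f x z + f y z" "\<And>x y z. f x (y + z) = f x y + f x z"
    and "\<And>c x y. f (s c x) y = t c (f x y)" "\<And>c x y. f x (s c y) = t c (f x y)"
  shows "bilinear_map s t f"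
  using assms by (simp add: bilinear_map_def Vector_Spaces.linear_iff)

lemma bilinear_map_simps:
  assumes "bilinear_map s t f"
  shows "f (x + y) z = f x z + f y z" "f x (y + z) = f x y + f x z"
    and "f (s c x) y = t c (f x y)" "f x (s c y) = t c (f x y)"
    and "f 0 y = 0" "f x 0 = 0" "f (- x) y = - f x y" "f x (- y) = - f x y"
    and "f (x - y) z = f x z - f y z" "f x (y - z) = f x y - f x z"
proof -
  have l: "additive (\<lambda>x. f x y)" and r: "additive (f x)" for x y
    using assms by (auto simp: bilinear_map_def Vector_Spaces.linear_iff additive_def)
  show "f (s c x) y = t c (f x y)" "f x (s c y) = t c (f x y)"
    using assms by (auto simp: bilinear_map_def Vector_Spaces.linear_iff)
  show "f (x + y) z = f x z + f y z" "f 0 y = 0" "f (- x) y = - f x y" "f (x - y) z = f x z - f y z"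
    using additive.add[OF l] additive.zero[OF l] additive.minus[OF l] additive.diff[OF l] by auto
  show "f x (y + z) = f x y + f x z" "f x 0 = 0" "f x (- y) = - f x y" "f x (y - z) = f x y - f x z"
    using additive.add[OF r] additive.zero[OF r] additive.minus[OF r] additive.diff[OF r] by auto
qed

lemma linear_map_simps:
  assumes "Vector_Spaces.linear s t f"
  shows "f (x + y) = f x + f y" "f (s c x) = t c (f x)" "f 0 = 0" "f (- x) = - f x" "f (x - y) = f x - f y"
proof -
  have l: "additive f"
    using assms by (auto simp: Vector_Spaces.linear_iff additive_def)
  show "f (x + y) = f x + f y" "f (s c x) = t c (f x)"
    using assms by (auto simp: Vector_Spaces.linear_iff)
  show "f 0 = 0" "f (- x) = - f x" "f (x - y) = f x - f y"
    using additive.zero[OF l] additive.minus[OF l] additive.diff[OF l] by auto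
qed


section \<open>Superspaces\<close>

context super_vector_space
begin

lemma vector_space_scl: "vector_space scl"
  by unfold_locales

lemma gr_closed:
  "0 \<in> gr a" "X \<in> gr a \<Longrightarrow> Y \<in> gr a \<Longrightarrow> X + Y \<in> gr a" "X \<in> gr a \<Longrightarrow> scl c X \<in> gr a"
  "X \<in> gr a \<Longrightarrow> - X \<in> gr a" "X \<in> gr a \<Longrightarrow> Y \<in> gr a \<Longrightarrow> X - Y \<in> gr a"
  using subspace_gr[of a] by (auto intro: subspace_0 subspace_add subspace_scale subspace_neg subspace_diff)

lemma hcomp_eqI:
  assumes "Y \<in> gr a" "X - Y \<in> gr (a + 1)"
  shows "hcomp gr a X = Y"
  unfolding hcomp_def
proof (rule the_equality)
  fix Z assume Z: "Z \<in> gr a \<and> X - Z \<in> gr (a + 1)"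
  have "Y - Z \<in> gr a" using Z assms by (auto intro: gr_closed)
  moreover have "(X - Z) - (X - Y) \<in> gr (a + 1)" using Z assms by (blast intro: gr_closed)
  then have "Y - Z \<in> gr (a + 1)" by simp
  ultimately have "Y - Z \<in> gr 0 \<inter> gr 1" by (cases a) auto
  then show "Z = Y" using gr_Int by simp
qed (use assms in simp)

lemma hcomp_gr: "X \<in> gr a \<Longrightarrow> hcomp gr b X = (if b = a then X else 0)"
  by (cases a; cases b) (auto intro!: hcomp_eqI simp: gr_closed)

lemma hcomp_in: "hcomp gr a X \<in> gr a" and hcomp_compl: "X - hcomp gr a X \<in> gr (a + 1)"
proof -
  obtain Y Z where "Y \<in> gr 0" "Z \<in> gr 1" "X = Y + Z" using gr_sum by blast
  then obtain Y where Y: "Y \<in> gr a" "X - Y \<in> gr (a + 1)" by (cases a) auto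
  then show "hcomp gr a X \<in> gr a" "X - hcomp gr a X \<in> gr (a + 1)"
    using hcomp_eqI by force+
qed

lemma hcomp_sum: "X = hcomp gr 0 X + hcomp gr 1 X"
proof -
  have "hcomp gr 1 X = X - hcomp gr 0 X"
    using hcomp_in[of 0 X] hcomp_compl[of X 0] by (intro hcomp_eqI) auto
  then show ?thesis by simp
qed

lemma linear_hcomp: "Vector_Spaces.linear scl scl (hcomp gr a)"
proof -
  have "(X + Y) - (hcomp gr a X + hcomp gr a Y) \<in> gr (a + 1)" for X Y
    using gr_closed(2)[OF hcomp_compl[of X a] hcomp_compl[of Y a]] by (simp add: algebra_simps)
  moreover have "scl c X - scl c (hcomp gr a X) \<in> gr (a + 1)" for c X
    using gr_closed(3)[OF hcomp_compl[of X a]] by (simp add: algebra_simps)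
  ultimately show ?thesis
    by (auto simp: Vector_Spaces.linear_iff vector_space_scl gr_closed hcomp_in intro!: hcomp_eqI)
qed

lemmas hcomp_simps = linear_map_simps[OF linear_hcomp]

lemma twist_eq: "twist scl gr d X = hcomp gr 0 X + scl (ssign d) (hcomp gr 1 X)"
  by (simp add: twist_def)

lemma linear_twist: "Vector_Spaces.linear scl scl (twist scl gr d)"
  by (auto simp: Vector_Spaces.linear_iff vector_space_scl twist_eq hcomp_simps algebra_simps)

lemma twist_gr: "X \<in> gr a \<Longrightarrow> twist scl gr d X = scl (ssign (d * a)) X"
  by (cases a) (auto simp: twist_eq hcomp_gr)

text \<open>This brings formulas that are extended linearly by means of homogeneous components back to
  the case of a homogeneous argument, where their signs are explicit.\<close>

lemma eq_of_homogeneous: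
  assumes "additive f" "additive g" "\<And>a X. X \<in> gr a \<Longrightarrow> f X = g X"
  shows "f X = g X"
proof -
  have "f (hcomp gr 0 X + hcomp gr 1 X) = g (hcomp gr 0 X + hcomp gr 1 X)"
    using assms(3)[OF hcomp_in[of 0 X]] assms(3)[OF hcomp_in[of 1 X]]
    by (simp only: additive.add[OF assms(1)] additive.add[OF assms(2)])
  then show ?thesis by (simp flip: hcomp_sum)
qed

end

lemma super_vector_space_prod:
  fixes s1 :: "'k::{alg_closed_field, field_char_0} \<Rightarrow> 'v::ab_group_add \<Rightarrow> 'v"
    and s2 :: "'k \<Rightarrow> 'w::ab_group_add \<Rightarrow> 'w"
  assumes "super_vector_space s1 g1" "super_vector_space s2 g2"
  shows "super_vector_space (module_prod.scale s1 s2) (\<lambda>c. g1 c \<times> g2 c)"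
proof -
  interpret v: super_vector_space s1 g1 by fact
  interpret w: super_vector_space s2 g2 by fact
  interpret vw: vector_space_prod s1 s2 by unfold_locales
  show ?thesis
  proof
    obtain B1 B2 where B: "finite B1" "v.span B1 = UNIV" "finite B2" "w.span B2 = UNIV"
      using v.finite_dimensional w.finite_dimensional by blast
    have "vw.p.span (B1 \<times> {0} \<union> {0} \<times> B2) = UNIV"
      unfolding vw.p.span_Un vw.span_Times_sing1 vw.span_Times_sing2 B by force
    then show "\<exists>B. finite B \<and> vw.p.span B = UNIV"
      using B by (metis finite.emptyI finite.insertI finite_SigmaI finite_Un)
    show "vw.p.subspace (g1 a \<times> g2 a)" for a
      by (intro vw.subspace_Times v.subspace_gr w.subspace_gr)
    show "g1 0 \<times> g2 0 \<inter> g1 1 \<times> g2 1 = {0}"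
      using v.gr_Int w.gr_Int by (auto simp: zero_prod_def)
    show "\<exists>y\<in>g1 0 \<times> g2 0. \<exists>z\<in>g1 1 \<times> g2 1. x = y + z" for x
    proof -
      obtain y z y' z' where "y \<in> g1 0" "z \<in> g1 1" "fst x = y + z"
        "y' \<in> g2 0" "z' \<in> g2 1" "snd x = y' + z'"
        using v.gr_sum w.gr_sum by metis
      then have "(y, y') \<in> g1 0 \<times> g2 0" "(z, z') \<in> g1 1 \<times> g2 1" "x = (y, y') + (z, z')"
        by (auto simp: prod_eq_iff)
      then show ?thesis by blast
    qed
  qed
qed

text \<open>The grading of the line \<open>K\<close> concentrated in degree \<open>d\<close>. Both \<open>Ke\<^sup>*\<close> and \<open>Ke\<close> are such lines,
  so that the two extended superspaces are products of superspaces.\<close>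

definition line_gr :: "bit \<Rightarrow> bit \<Rightarrow> 'k::zero set" where
  "line_gr d c = {a. a = 0 \<or> c = d}"

lemma super_vector_space_line:
  "super_vector_space ((*) :: 'k::{alg_closed_field, field_char_0} \<Rightarrow> 'k \<Rightarrow> 'k) (line_gr d)"
proof -
  interpret vector_space "(*) :: 'k \<Rightarrow> 'k \<Rightarrow> 'k" by (rule vector_space_field)
  show ?thesis
  proof
    have "span {1} = (UNIV :: 'k set)" by (auto simp: span_singleton)
    then show "\<exists>B::'k set. finite B \<and> span B = UNIV" by blast
    show "subspace (line_gr d a)" for a by (auto simp: subspace_def line_gr_def)
    show "line_gr d 0 \<inter> line_gr d 1 = {0::'k}" by (auto simp: line_gr_def)
    show "\<exists>y\<in>line_gr d 0. \<exists>z\<in>line_gr d 1. x = y + z" for x :: 'k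
      by (cases d) (auto simp: line_gr_def)
  qed
qed

section \<open>Lie superalgebras\<close>

context lie_superalgebra
begin

lemmas br_simps = bilinear_map_simps[OF bilinear_br]

end

lemma superderivationD:
  assumes "superderivation scl gr br d D"
  shows "Vector_Spaces.linear scl scl D"
    and "X \<in> gr a \<Longrightarrow> D X \<in> gr (a + d)"
    and "X \<in> gr a \<Longrightarrow> D (br X Y) = br (D X) Y + scl (ssign (d * a)) (br X (D Y))"
  using assms by (auto simp: superderivation_def)

lemma scalar_2_cocycleD:
  assumes "scalar_2_cocycle scl gr br f"
  shows "bilinear_map scl (*) f"
    and "X \<in> gr a \<Longrightarrow> Y \<in> gr b \<Longrightarrow> f X Y = - ssign (a * b) * f Y X"
    and "X \<in> gr a \<Longrightarrow> Y \<in> gr b \<Longrightarrow> Z \<in> gr c \<Longrightarrow>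
      ssign (c * a) * f X (br Y Z) + ssign (a * b) * f Y (br Z X) + ssign (b * c) * f Z (br X Y) = 0"
  using assms unfolding scalar_2_cocycle_def skew_supersymmetric_def by blast+

text \<open>The operator \<open>L\<^sub>D\<close> on bilinear forms; the twist supplies the sign \<open>(-1)\<^bsup>d |X|\<^esup>\<close>, so that the
  result is bilinear and not only given on homogeneous elements.\<close>

definition lie_derivative ::
  "('k::field \<Rightarrow> 'v::ab_group_add \<Rightarrow> 'v) \<Rightarrow> (bit \<Rightarrow> 'v set) \<Rightarrow> bit \<Rightarrow> ('v \<Rightarrow> 'v) \<Rightarrow> ('v \<Rightarrow> 'v \<Rightarrow> 'k)
    \<Rightarrow> 'v \<Rightarrow> 'v \<Rightarrow> 'k" where
  "lie_derivative scl gr d D f X Y = f (D X) Y + f (twist scl gr d X) (D Y)"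

context super_vector_space
begin

lemma bilinear_lie_derivative:
  assumes "bilinear_map scl (*) f" "Vector_Spaces.linear scl scl D"
  shows "bilinear_map scl (*) (lie_derivative scl gr d D f)"
  using bilinear_map_simps[OF assms(1)] linear_map_simps[OF assms(2)] linear_map_simps[OF linear_twist[of d]]
  by (intro bilinear_mapI) (auto simp: lie_derivative_def algebra_simps vector_space_scl vector_space_field)

lemma lie_derivative_gr:
  assumes "bilinear_map scl (*) f" "X \<in> gr a"
  shows "lie_derivative scl gr d D f X Y = f (D X) Y + ssign (d * a) * f X (D Y)"
  using assms by (simp add: lie_derivative_def twist_gr bilinear_map_simps[OF assms(1)])

lemma homogeneous_lie_derivative:
  assumes f: "bilinear_map scl (*) f" and h: "homogeneous_form gr c f"
    and D: "\<And>a X. X \<in> gr a \<Longrightarrow> D X \<in> gr (a + d)"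
  shows "homogeneous_form gr (c + d) (lie_derivative scl gr d D f)"
  unfolding homogeneous_form_def
proof (intro allI impI ballI)
  fix a b X Y assume *: "a + b \<noteq> c + d" "X \<in> gr a" "Y \<in> gr b"
  then have "a + d + b \<noteq> c" "a + (b + d) \<noteq> c" by (cases a; cases b; cases c; cases d; simp)+
  then have "f (D X) Y = 0" "f X (D Y) = 0"
    using h D[OF *(2)] D[OF *(3)] * unfolding homogeneous_form_def by blast+
  then show "lie_derivative scl gr d D f X Y = 0"
    using * by (simp add: lie_derivative_gr[OF f])
qed

end

context lie_superalgebra
begin

text \<open>
  With \<open>J\<close> the cyclic sum in the cocycle identity, the derivation rule gives
  \<open>J(L\<^sub>D f)(X, Y, Z) = (-1)\<^bsup>d |Z|\<^esup> J f (D X, Y, Z) + (-1)\<^bsup>d |X|\<^esup> J f (X, D Y, Z) + (-1)\<^bsup>d |Y|\<^esup> J f (X, Y, D Z)\<close>.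
  The signs come from the prefactors \<open>(-1)\<^bsup>|Z| |X|\<^esup>\<close> etc., in which one degree is shifted by \<open>d\<close>.
\<close>

lemma cocycle_lie_derivative:
  assumes D: "superderivation scl gr br d D" and f: "scalar_2_cocycle scl gr br f"
  shows "scalar_2_cocycle scl gr br (lie_derivative scl gr d D f)"
proof -
  note D = superderivationD[OF D]
  note bil = scalar_2_cocycleD(1)[OF f]
  note skew = scalar_2_cocycleD(2)[OF f]
  note coc = scalar_2_cocycleD(3)[OF f]
  note L = lie_derivative_gr[OF bil]
  show ?thesis
    unfolding scalar_2_cocycle_def
  proof (intro conjI allI ballI)
    show "bilinear_map scl (*) (lie_derivative scl gr d D f)"
      by (rule bilinear_lie_derivative[OF bil D(1)])
    show "\<exists>c. homogeneous_form gr c (lie_derivative scl gr d D f)"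
      using f homogeneous_lie_derivative[OF bil] D(2) unfolding scalar_2_cocycle_def by blast
    show "skew_supersymmetric gr (lie_derivative scl gr d D f)"
      unfolding skew_supersymmetric_def
    proof (intro allI ballI)
      fix a b X Y assume X: "X \<in> gr a" and Y: "Y \<in> gr b"
      show "lie_derivative scl gr d D f X Y = - ssign (a * b) * lie_derivative scl gr d D f Y X"
        using skew[OF D(2)[OF X] Y] skew[OF X D(2)[OF Y]]
        by (simp add: L[OF X] L[OF Y]) (cases a; cases b; cases d; simp)
    qed
    fix a b c X Y Z assume X: "X \<in> gr a" and Y: "Y \<in> gr b" and Z: "Z \<in> gr c"
    let ?J = "\<lambda>a b c X Y Z. ssign (c * a) * f X (br Y Z) + ssign (a * b) * f Y (br Z X)
      + ssign (b * c) * f Z (br X Y)"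
    let ?L = "lie_derivative scl gr d D f"
    have "ssign (c * a) * ?L X (br Y Z) + ssign (a * b) * ?L Y (br Z X) + ssign (b * c) * ?L Z (br X Y)
      = ssign (d * c) * ?J (a + d) b c (D X) Y Z + ssign (d * a) * ?J a (b + d) c X (D Y) Z
        + ssign (d * b) * ?J a b (c + d) X Y (D Z)"
      unfolding L[OF X] L[OF Y] L[OF Z] D(3)[OF X] D(3)[OF Y] D(3)[OF Z]
      by (simp add: bilinear_map_simps[OF bil]) (cases a; cases b; cases c; cases d; simp add: algebra_simps)
    also have "\<dots> = 0"
      by (simp only: coc[OF D(2)[OF X] Y Z] coc[OF X D(2)[OF Y] Z] coc[OF X Y D(2)[OF Z]]) simp
    finally show "ssign (c * a) * ?L X (br Y Z) + ssign (a * b) * ?L Y (br Z X)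
      + ssign (b * c) * ?L Z (br X Y) = 0" .
  qed
qed

lemma cocycle_uminus:
  assumes f: "scalar_2_cocycle scl gr br f"
  shows "scalar_2_cocycle scl gr br (\<lambda>X Y. - f X Y)"
proof -
  have "bilinear_map scl (*) (\<lambda>X Y. - f X Y)"
    using bilinear_map_simps[OF scalar_2_cocycleD(1)[OF f]]
    by (intro bilinear_mapI) (auto simp: vector_space_scl vector_space_field)
  moreover have "ssign (c * a) * - f X (br Y Z) + ssign (a * b) * - f Y (br Z X)
      + ssign (b * c) * - f Z (br X Y) = 0" if "X \<in> gr a" "Y \<in> gr b" "Z \<in> gr c" for X Y Z a b c
    using arg_cong[OF scalar_2_cocycleD(3)[OF f that], of uminus] by simp
  moreover have "\<exists>d. homogeneous_form gr d (\<lambda>X Y. - f X Y)"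
    using f by (simp add: scalar_2_cocycle_def homogeneous_form_def)
  moreover have "skew_supersymmetric gr (\<lambda>X Y. - f X Y)"
    unfolding skew_supersymmetric_def
  proof (intro allI ballI)
    fix a b X Y assume "X \<in> gr a" "Y \<in> gr b"
    from scalar_2_cocycleD(2)[OF f this]
    show "- f X Y = - ssign (a * b) * - f Y X" by simp
  qed
  ultimately show ?thesis
    unfolding scalar_2_cocycle_def by blast
qed

end

section \<open>Central extensions and extensions by a superderivation\<close>

lemma ext_gr_eq: "ext_gr gr e c = line_gr (e + 1) c \<times> gr c"
  by (auto simp: ext_gr_def line_gr_def)

lemma (in vector_space) ext_scale_Pair: "ext_scale scale c (a, X) = (c * a, scale c X)"
proof -
  interpret k: vector_space "(*) :: 'a \<Rightarrow> 'a \<Rightarrow> 'a" by (rule vector_space_field)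
  interpret vector_space_prod "(*) :: 'a \<Rightarrow> 'a \<Rightarrow> 'a" scale by unfold_locales
  show ?thesis by (simp add: ext_scale_def scale_prod)
qed

lemma (in vector_space) line_scale_Pair: "module_prod.scale scale (*) c (X, a) = (scale c X, c * a)"
proof -
  interpret k: vector_space "(*) :: 'a \<Rightarrow> 'a \<Rightarrow> 'a" by (rule vector_space_field)
  interpret vector_space_prod scale "(*) :: 'a \<Rightarrow> 'a \<Rightarrow> 'a" by unfold_locales
  show ?thesis by (simp add: scale_prod)
qed

context lie_superalgebra
begin

lemma super_vector_space_ext: "super_vector_space (ext_scale scl) (ext_gr gr e)"
  unfolding ext_scale_def ext_gr_eq[abs_def]
  by (intro super_vector_space_prod super_vector_space_line super_vector_space_axioms)

text \<open>
  A bracket never sees the central components, so the \<open>e\<^sup>*\<close>-component of the Jacobi identity is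
  precisely the cocycle identity of \<open>\<gamma>\<close>. The degree \<open>e + 1\<close> of \<open>\<gamma>\<close> is that of \<open>e\<^sup>*\<close>.
\<close>

lemma lie_superalgebra_central_extension:
  assumes \<gamma>: "scalar_2_cocycle scl gr br \<gamma>" and hom: "homogeneous_form gr (e + 1) \<gamma>"
  shows "lie_superalgebra (ext_scale scl) (ext_gr gr e) (ext_br br \<gamma>)"
proof -
  interpret E: super_vector_space "ext_scale scl" "ext_gr gr e" by (rule super_vector_space_ext)
  note \<gamma>_simps = bilinear_map_simps[OF scalar_2_cocycleD(1)[OF \<gamma>]]
  show ?thesis
  proof
    show "bilinear_map (ext_scale scl) (ext_scale scl) (ext_br br \<gamma>)"
      by (intro bilinear_mapI E.vector_space_scl)
        (auto simp: ext_br_def ext_scale_Pair \<gamma>_simps br_simps)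
  next
    fix U V :: "'k \<times> 'v" and a b assume UV: "U \<in> ext_gr gr e a" "V \<in> ext_gr gr e b"
    obtain k X l Y where eq: "U = (k, X)" "V = (l, Y)" by fastforce
    have X: "X \<in> gr a" and Y: "Y \<in> gr b" using UV by (auto simp: eq ext_gr_def)
    show "ext_br br \<gamma> U V \<in> ext_gr gr e (a + b)"
      using hom X Y br_gr[OF X Y] by (auto simp: eq ext_gr_def ext_br_def homogeneous_form_def)
  next
    fix U V :: "'k \<times> 'v" and a b assume UV: "U \<in> ext_gr gr e a" "V \<in> ext_gr gr e b"
    obtain k X l Y where eq: "U = (k, X)" "V = (l, Y)" by fastforce
    have X: "X \<in> gr a" and Y: "Y \<in> gr b" using UV by (auto simp: eq ext_gr_def)
    show "ext_br br \<gamma> U V = - ext_scale scl (ssign (a * b)) (ext_br br \<gamma> V U)"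
      using br_skew[OF X Y] scalar_2_cocycleD(2)[OF \<gamma> X Y]
      by (simp add: eq ext_br_def ext_scale_Pair)
  next
    fix U V W :: "'k \<times> 'v" and a b c assume UVW: "U \<in> ext_gr gr e a" "V \<in> ext_gr gr e b" "W \<in> ext_gr gr e c"
    obtain k X l Y m Z where eq: "U = (k, X)" "V = (l, Y)" "W = (m, Z)" by (metis surj_pair)
    have XYZ: "X \<in> gr a" "Y \<in> gr b" "Z \<in> gr c" using UVW by (auto simp: eq ext_gr_def)
    show "ext_scale scl (ssign (c * a)) (ext_br br \<gamma> U (ext_br br \<gamma> V W))
      + ext_scale scl (ssign (a * b)) (ext_br br \<gamma> V (ext_br br \<gamma> W U))
      + ext_scale scl (ssign (b * c)) (ext_br br \<gamma> W (ext_br br \<gamma> U V)) = 0"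
      using br_jacobi[OF XYZ] scalar_2_cocycleD(3)[OF \<gamma> XYZ]
      by (simp add: eq ext_br_def ext_scale_Pair zero_prod_def)
  qed
qed

end

text \<open>
  The pair \<open>(u, s)\<close> stands for \<open>u + s e\<close>, where \<open>[e, u] = \<delta> u\<close> and \<open>[e, e] = h0\<close>. The bracket has no
  component along \<open>e\<close>: the original algebra is an ideal with one-dimensional quotient.
\<close>

definition derivation_ext_br ::
  "('k::field \<Rightarrow> 'v::ab_group_add \<Rightarrow> 'v) \<Rightarrow> (bit \<Rightarrow> 'v set) \<Rightarrow> ('v \<Rightarrow> 'v \<Rightarrow> 'v) \<Rightarrow> bit \<Rightarrow> ('v \<Rightarrow> 'v) \<Rightarrow> 'v
    \<Rightarrow> 'v \<times> 'k \<Rightarrow> 'v \<times> 'k \<Rightarrow> 'v \<times> 'k" where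
  "derivation_ext_br scl gr br e \<delta> h0 = (\<lambda>(u, s) (v, t).
    (br u v + scl s (\<delta> v) - scl t (\<delta> (twist scl gr e u)) + scl (s * t) h0, 0))"

context lie_superalgebra
begin

text \<open>
  The Jacobi identity splits by the number of occurrences of \<open>e\<close>: with one it says that \<open>\<delta>\<close> is a
  superderivation, with two that \<open>(1 - (-1)\<^bsup>e\<^esup>) \<delta>\<^sup>2 = [h0, _]\<close>, and with three that \<open>\<delta> h0 = 0\<close>. For
  even \<open>e\<close>, skew-supersymmetry forces \<open>[e, e] = 0\<close>.
\<close>

lemma lie_superalgebra_derivation_extension:
  assumes \<delta>: "superderivation scl gr br e \<delta>" and h0: "h0 \<in> gr 0" "\<delta> h0 = 0"
    and even: "e = 0 \<Longrightarrow> h0 = 0" and odd: "\<And>u. e = 1 \<Longrightarrow> scl 2 (\<delta> (\<delta> u)) = br h0 u"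
  shows "lie_superalgebra (module_prod.scale scl (*)) (\<lambda>c. gr c \<times> line_gr e c)
    (derivation_ext_br scl gr br e \<delta> h0)" (is "lie_superalgebra ?scl ?gr ?br")
proof -
  interpret E: super_vector_space ?scl ?gr
    by (intro super_vector_space_prod super_vector_space_line super_vector_space_axioms)
  note D = superderivationD[OF \<delta>]
  note Ds = linear_map_simps[OF D(1)]
  note ts = linear_map_simps[OF linear_twist]
  have br_hom: "?br (u, s) (v, t) = (br u v + scl s (\<delta> v) - scl (t * ssign (e * a)) (\<delta> u) + scl (s * t) h0, 0)"
    if "u \<in> gr a" for u s v t a
    using that by (simp add: derivation_ext_br_def twist_gr Ds)
  show ?thesis
  proof
    show "bilinear_map ?scl ?scl ?br"
      by (intro bilinear_mapI E.vector_space_scl)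
        (auto simp: derivation_ext_br_def line_scale_Pair br_simps Ds ts algebra_simps)
  next
    fix U V a b assume U: "U \<in> ?gr a" and V: "V \<in> ?gr b"
    obtain u s v t where UV: "U = (u, s)" "V = (v, t)" by fastforce
    have u: "u \<in> gr a" "s = 0 \<or> a = e" and v: "v \<in> gr b" "t = 0 \<or> b = e"
      using U V by (auto simp: UV line_gr_def)
    have "scl s (\<delta> v) \<in> gr (a + b)"
      using u v D(2)[OF v(1)] gr_closed by (auto simp: add.commute)
    moreover have "scl (t * ssign (e * a)) (\<delta> u) \<in> gr (a + b)"
      using u v D(2)[OF u(1)] gr_closed by (auto simp: add.commute)
    moreover have "scl (s * t) h0 \<in> gr (a + b)"
      using u v h0 even gr_closed by (cases e) auto
    ultimately show "?br U V \<in> ?gr (a + b)"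
      using br_gr[OF u(1) v(1)] gr_closed by (simp add: UV br_hom[OF u(1)] line_gr_def)
    have "?br (u, s) (v, t) = - ?scl (ssign (a * b)) (?br (v, t) (u, s))"
      unfolding br_hom[OF u(1)] br_hom[OF v(1)] br_skew[OF u(1) v(1)]
      using u(2) v(2) even
      by (cases a; cases b; cases e) (auto simp: line_scale_Pair mult.commute)
    then show "?br U V = - ?scl (ssign (a * b)) (?br V U)" by (simp add: UV)
  next
    fix U V W a b c assume U: "U \<in> ?gr a" and V: "V \<in> ?gr b" and W: "W \<in> ?gr c"
    obtain u s v t w r where UVW: "U = (u, s)" "V = (v, t)" "W = (w, r)" by (metis surj_pair)
    have u: "u \<in> gr a" "s = 0 \<or> a = e" and v: "v \<in> gr b" "t = 0 \<or> b = e"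
      and w: "w \<in> gr c" "r = 0 \<or> c = e"
      using U V W by (auto simp: UVW line_gr_def)
    show "?scl (ssign (c * a)) (?br U (?br V W)) + ?scl (ssign (a * b)) (?br V (?br W U))
      + ?scl (ssign (b * c)) (?br W (?br U V)) = 0"
    proof -
      have br0: "?br (x, k) (y, 0) = (br x y + scl k (\<delta> y), 0)" for x y k
        by (simp add: derivation_ext_br_def ts Ds)
      have skew: "br u (\<delta> w) = - scl (ssign (a * (c + e))) (br (\<delta> w) u)"
        "br v (\<delta> u) = - scl (ssign (b * (a + e))) (br (\<delta> u) v)"
        "br w (\<delta> v) = - scl (ssign (c * (b + e))) (br (\<delta> v) w)"
        using br_skew D(2) u v w by blast+
      have skew0: "br u h0 = - br h0 u" "br v h0 = - br h0 v" "br w h0 = - br h0 w"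
        using br_skew[OF u(1) h0(1)] br_skew[OF v(1) h0(1)] br_skew[OF w(1) h0(1)] by simp_all
      have sq: "br h0 x = \<delta> (\<delta> x) + \<delta> (\<delta> x)" if "e = 1" for x
        using odd[OF that, of x] scale_left_distrib[of 1 1 "\<delta> (\<delta> x)"] by simp
      \<comment> \<open>With \<open>[u, \<delta> w]\<close>, \<open>[v, \<delta> u]\<close>, \<open>[w, \<delta> v]\<close> turned around, every term with a factor \<open>s\<close>, \<open>t\<close> or
        \<open>r\<close> cancels in each case of the degrees.\<close>
      have "fst (?scl (ssign (c * a)) (?br U (?br V W)) + ?scl (ssign (a * b)) (?br V (?br W U))
          + ?scl (ssign (b * c)) (?br W (?br U V)))
        = scl (ssign (c * a)) (br u (br v w)) + scl (ssign (a * b)) (br v (br w u))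
          + scl (ssign (b * c)) (br w (br u v))"
        unfolding UVW br_hom[OF u(1)] br_hom[OF v(1)] br_hom[OF w(1)] br0
        using u(2) v(2) w(2) even
        by (simp add: line_scale_Pair br_simps Ds h0 D(3)[OF u(1)] D(3)[OF v(1)] D(3)[OF w(1)] skew skew0)
          (cases e; cases a; cases b; cases c; simp add: sq br_simps algebra_simps)
      also have "\<dots> = 0" by (rule br_jacobi[OF u(1) v(1) w(1)])
      finally show ?thesis
        by (simp add: prod_eq_iff UVW derivation_ext_br_def line_scale_Pair split_beta)
    qed
  qed
qed

end


section \<open>Odd-symplectic forms\<close>

lemma odd_form_homogeneous:
  assumes "odd_form gr f"
  shows "homogeneous_form gr 1 f"
proof -
  have "a = b" if "a + b \<noteq> 1" for a b :: bit using that by (cases a; cases b) auto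
  then show ?thesis using assms unfolding odd_form_def homogeneous_form_def by blast
qed

context super_vector_space
begin

lemma bilinear_eq_of_homogeneous:
  assumes "bilinear_map scl t f" "bilinear_map scl t g"
    and "\<And>a b X Y. X \<in> gr a \<Longrightarrow> Y \<in> gr b \<Longrightarrow> f X Y = g X Y"
  shows "f X Y = g X Y"
proof -
  have r: "additive (f X)" "additive (g X)" and l: "additive (\<lambda>X. f X Y)" "additive (\<lambda>X. g X Y)" for X Y
    by (simp_all only: additive_def bilinear_map_simps(1,2)[OF assms(1)] bilinear_map_simps(1,2)[OF assms(2)]) auto
  have "f X Y = g X Y" if "X \<in> gr a" for a X Y
    by (rule eq_of_homogeneous[OF r]) (rule assms(3)[OF that])
  then show ?thesis
    by (rule eq_of_homogeneous[OF l])
qed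

text \<open>
  In a basis \<open>B\<close>, the map that sends \<open>X\<close> to the vector with coordinates \<open>\<omega>(X, b)\<close> is an injective
  endomorphism by non-degeneracy, hence surjective, so every tuple of values on \<open>B\<close> occurs.
\<close>

lemma functional_represented:
  assumes \<omega>: "bilinear_map scl (*) \<omega>" and nd: "\<And>X. (\<And>Y. \<omega> X Y = 0) \<Longrightarrow> X = 0"
    and f: "Vector_Spaces.linear scl (*) f"
  shows "\<exists>Z. \<forall>Y. \<omega> Z Y = f Y"
proof -
  obtain C where C: "finite C" "span C = UNIV" using finite_dimensional by blast
  obtain B where B: "B \<subseteq> C" "independent B" "C \<subseteq> span B"
    using maximal_independent_subset[of C] by blast
  have "span B = UNIV" using B C by (metis span_mono span_span top.extremum_unique)
  then interpret fd: finite_dimensional_vector_space scl B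
    using B C by unfold_locales (auto intro: finite_subset)
  interpret k: vector_space "(*) :: 'k \<Rightarrow> 'k \<Rightarrow> 'k" by (rule vector_space_field)
  interpret vk: vector_space_pair scl "(*) :: 'k \<Rightarrow> 'k \<Rightarrow> 'k" by unfold_locales
  have lin: "Vector_Spaces.linear scl (*) (\<omega> X)" for X
    using \<omega> by (simp add: bilinear_map_def)
  have on_basis: "\<omega> X Y = g Y" if "\<And>b. b \<in> B \<Longrightarrow> \<omega> X b = g b" "Vector_Spaces.linear scl (*) g" for X Y g
    using vk.linear_eq_on[OF lin[of X] that(2), of Y B] that(1) fd.span_Basis by auto
  \<comment> \<open>Identifying the dual space with the space itself through \<open>B\<close> makes \<open>X \<mapsto> \<omega>(X, _)\<close> an
    endomorphism.\<close>
  define T where "T X = (\<Sum>b\<in>B. scl (\<omega> X b) b)" for X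
  have coeffs: "p = q" if "(\<Sum>b\<in>B. scl (p b) b) = (\<Sum>b\<in>B. scl (q b) b)" "\<And>b. b \<notin> B \<Longrightarrow> p b = q b" for p q
  proof -
    have "(\<Sum>b\<in>B. scl (p b - q b) b) = 0"
      using that(1) by (simp add: scale_left_diff_distrib sum_subtractf)
    then show ?thesis
      using independentD[OF B(2) fd.finite_Basis subset_refl] that(2) by force
  qed
  have "Vector_Spaces.linear scl scl T"
    by (auto simp: Vector_Spaces.linear_iff vector_space_scl T_def bilinear_map_simps[OF \<omega>]
        scale_left_distrib sum.distrib scale_sum_right)
  moreover have "inj T"
  proof (rule injI)
    fix X Y assume "T X = T Y"
    then have "\<omega> X b = \<omega> Y b" if "b \<in> B" for b
      using coeffs[of "\<lambda>b. if b \<in> B then \<omega> X b else 0" "\<lambda>b. if b \<in> B then \<omega> Y b else 0"] that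
      by (auto simp: T_def dest: fun_cong[of _ _ b])
    then have "\<omega> X Z = \<omega> Y Z" for Z using on_basis lin by blast
    then have "X - Y = 0" by (intro nd) (simp add: bilinear_map_simps[OF \<omega>])
    then show "X = Y" by simp
  qed
  ultimately have "surj T" by (rule fd.linear_inj_imp_surj)
  then obtain Z where "T Z = (\<Sum>b\<in>B. scl (f b) b)" by (metis surjD)
  then have "\<omega> Z b = f b" if "b \<in> B" for b
    using coeffs[of "\<lambda>b. if b \<in> B then \<omega> Z b else 0" "\<lambda>b. if b \<in> B then f b else 0"] that
    by (auto simp: T_def dest: fun_cong[of _ _ b])
  then show ?thesis using on_basis f by blast
qed

lemma form_adjoint_props:
  assumes \<omega>: "bilinear_map scl (*) \<omega>" and nd: "nondegenerate_form \<omega>"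
    and D: "Vector_Spaces.linear scl scl D"
  shows "Vector_Spaces.linear scl scl (form_adjoint scl \<omega> D)"
    and "\<omega> (form_adjoint scl \<omega> D X) Y = \<omega> X (D Y)"
proof -
  note \<omega>s = bilinear_map_simps[OF \<omega>] and Ds = linear_map_simps[OF D]
  have nd0: "X = 0" if "\<And>Y. \<omega> X Y = 0" for X
    using nd that by (auto simp: nondegenerate_form_def)
  have eqI: "X = Y" if "\<And>Z. \<omega> X Z = \<omega> Y Z" for X Y
    using nd0[of "X - Y"] that by (simp add: \<omega>s)
  have "\<exists>Z. \<forall>Y. \<omega> Z Y = \<omega> X (D Y)" for X
    by (rule functional_represented[OF \<omega> nd0])
      (auto simp: Vector_Spaces.linear_iff vector_space_scl vector_space_field \<omega>s Ds)
  then obtain D' where D': "\<And>X Y. \<omega> (D' X) Y = \<omega> X (D Y)" by metis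
  have "Vector_Spaces.linear scl scl D'"
    by (auto simp: Vector_Spaces.linear_iff vector_space_scl \<omega>s D' intro!: eqI)
  then have "\<exists>!D'. Vector_Spaces.linear scl scl D' \<and> (\<forall>X Y. \<omega> (D' X) Y = \<omega> X (D Y))"
    using D' by (intro ex1I[of _ D']) (auto intro!: eqI ext)
  from theI'[OF this] show "Vector_Spaces.linear scl scl (form_adjoint scl \<omega> D)"
    "\<omega> (form_adjoint scl \<omega> D X) Y = \<omega> X (D Y)"
    by (auto simp: form_adjoint_def)
qed

end

context odd_symplectic_lie_superalgebra
begin

lemmas bilinear_form = scalar_2_cocycleD(1)[OF cocycle]
lemmas form_simps = bilinear_map_simps[OF bilinear_form]

lemma form_gr_eq_0: "X \<in> gr a \<Longrightarrow> Y \<in> gr a \<Longrightarrow> \<omega> X Y = 0"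
  using odd by (auto simp: odd_form_def)

lemma homogeneous_form: "homogeneous_form gr 1 \<omega>"
  by (rule odd_form_homogeneous[OF odd])

text \<open>Degrees \<open>a \<noteq> b\<close> have \<open>a b = 0\<close>, and on equal degrees both sides vanish.\<close>

lemma form_antisym: "\<omega> X Y = - \<omega> Y X"
proof (rule bilinear_eq_of_homogeneous[OF bilinear_form, of "\<lambda>X Y. - \<omega> Y X"])
  show "bilinear_map scl (*) (\<lambda>X Y. - \<omega> Y X)"
    by (intro bilinear_mapI vector_space_scl vector_space_field) (auto simp: form_simps)
  show "\<omega> X Y = - \<omega> Y X" if "X \<in> gr a" "Y \<in> gr b" for a b X Y
    using scalar_2_cocycleD(2)[OF cocycle that] that form_gr_eq_0[of X _ Y] form_gr_eq_0[of Y _ X]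
    by (cases a; cases b) auto
qed

text \<open>The cocycle identity, once an even argument has removed two of its three signs and the third
  has been absorbed as in \<open>form_antisym\<close>.\<close>

lemma form_br_even:
  assumes "Z \<in> gr 0"
  shows "\<omega> Z (br X Y) = \<omega> (br Z X) Y + \<omega> X (br Z Y)"
proof (rule bilinear_eq_of_homogeneous[where f = "\<lambda>X Y. \<omega> Z (br X Y)"
      and g = "\<lambda>X Y. \<omega> (br Z X) Y + \<omega> X (br Z Y)"])
  show "bilinear_map scl (*) (\<lambda>X Y. \<omega> Z (br X Y))"
    "bilinear_map scl (*) (\<lambda>X Y. \<omega> (br Z X) Y + \<omega> X (br Z Y))"
    by (intro bilinear_mapI vector_space_scl vector_space_field;
        simp add: form_simps br_simps algebra_simps)+
  show "\<omega> Z (br X Y) = \<omega> (br Z X) Y + \<omega> X (br Z Y)" if X: "X \<in> gr a" and Y: "Y \<in> gr b" for a b X Y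
    using scalar_2_cocycleD(3)[OF cocycle assms X Y] br_skew[OF Y assms] form_antisym[of Y "br Z X"]
      form_gr_eq_0[OF _ Y, of "br Z X"] br_gr[OF assms X]
    by (cases a; cases b) (auto simp: form_simps add_eq_0_iff algebra_simps)
qed

text \<open>
  Moving each \<open>D\<^sup>*\<close> to the second argument turns \<open>\<theta>(X, Y)\<close> into a combination of
  \<open>\<omega>(D\<^sup>2 X, Y)\<close>, \<open>\<omega>(D X, D Y)\<close> and \<open>\<omega>(X, D\<^sup>2 Y)\<close>, which is the expansion of \<open>L\<^sub>D (L\<^sub>D \<omega>)\<close>.
\<close>

lemma theta_form_eq:
  assumes D: "superderivation scl gr br e D"
  shows "theta_form scl gr \<omega> e D
    = lie_derivative scl gr e D (lie_derivative scl gr e D \<omega>)"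
proof (intro ext)
  fix X Y
  note DD = superderivationD[OF D]
  note adj = form_adjoint_props[OF bilinear_form nondegenerate DD(1)]
  note L = bilinear_lie_derivative[OF bilinear_form DD(1)]
  \<comment> \<open>The contribution of a homogeneous component, with \<open>s\<close> and \<open>s'\<close> the signs in the two brackets of
    the definition of \<open>\<theta>\<close>.\<close>
  define g where "g s s' Z = s * \<omega> (D Z) (D Y) + \<omega> Z (D (D Y)) + \<omega> (D (D Z)) Y + s' * \<omega> (D Z) (D Y)"
    for s s' Z
  have theta: "theta_form scl gr \<omega> e D X Y = g 1 (ssign e) (hcomp gr 0 X) + g (ssign e) 1 (hcomp gr 1 X)" for X
    unfolding g_def theta_form_def Let_def
    by (simp add: form_simps linear_map_simps[OF adj(1)] adj(2))
  have g: "g s s' (Z + W) = g s s' Z + g s s' W" "g s s' 0 = 0" for s s' Z W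
    by (simp_all add: g_def form_simps linear_map_simps[OF DD(1)] algebra_simps)
  show "theta_form scl gr \<omega> e D X Y = lie_derivative scl gr e D (lie_derivative scl gr e D \<omega>) X Y"
  proof (rule eq_of_homogeneous[where f = "\<lambda>X. theta_form scl gr \<omega> e D X Y"
        and g = "\<lambda>X. lie_derivative scl gr e D (lie_derivative scl gr e D \<omega>) X Y"])
    show "additive (\<lambda>X. theta_form scl gr \<omega> e D X Y)"
      by (simp add: additive_def theta g hcomp_simps algebra_simps)
    show "additive (\<lambda>X. lie_derivative scl gr e D (lie_derivative scl gr e D \<omega>) X Y)"
      using bilinear_map_simps(1)[OF bilinear_lie_derivative[OF L DD(1)]] by (simp add: additive_def)
    fix a X assume X: "X \<in> gr a"
    show "theta_form scl gr \<omega> e D X Y = lie_derivative scl gr e D (lie_derivative scl gr e D \<omega>) X Y"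
      unfolding theta lie_derivative_gr[OF L X] lie_derivative_gr[OF bilinear_form X]
        lie_derivative_gr[OF bilinear_form DD(2)[OF X]]
      by (cases a; cases e) (simp_all add: hcomp_gr[OF X] g_def form_simps(5) linear_map_simps(3)[OF DD(1)])
  qed
qed

lemma gamma_form_eq: "gamma_form scl gr \<omega> e D X Y = - lie_derivative scl gr e D \<omega> X Y"
  by (simp add: gamma_form_def lie_derivative_def)

text \<open>
  For odd \<open>D\<close> the mixed terms of \<open>L\<^sub>D (L\<^sub>D \<omega>)\<close> cancel, which leaves \<open>\<omega>(D\<^sup>2 X, Y) + \<omega>(X, D\<^sup>2 Y)\<close>. With
  \<open>2 D\<^sup>2 = [x0, _]\<close> this is a coboundary by \<open>form_br_even\<close>.
\<close>

lemma theta_form_odd: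
  assumes D: "superderivation scl gr br 1 D" and x0: "x0 \<in> gr 0"
    and sq: "\<And>X. D (D X) = scl (1 / 2) (br x0 X)"
  shows "theta_form scl gr \<omega> 1 D X Y = \<omega> (scl (1 / 2) x0) (br X Y)"
proof (rule eq_of_homogeneous[where f = "\<lambda>X. theta_form scl gr \<omega> 1 D X Y"
      and g = "\<lambda>X. \<omega> (scl (1 / 2) x0) (br X Y)"])
  note DD = superderivationD[OF D]
  note L = bilinear_lie_derivative[OF bilinear_form DD(1)]
  show "additive (\<lambda>X. theta_form scl gr \<omega> 1 D X Y)"
    unfolding theta_form_eq[OF D]
    using bilinear_map_simps(1)[OF bilinear_lie_derivative[OF L DD(1)]] by (simp add: additive_def)
  show "additive (\<lambda>X. \<omega> (scl (1 / 2) x0) (br X Y))"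
    by (simp add: additive_def form_simps br_simps algebra_simps)
  show "theta_form scl gr \<omega> 1 D X Y = \<omega> (scl (1 / 2) x0) (br X Y)" if X: "X \<in> gr a" for a X
    unfolding theta_form_eq[OF D] lie_derivative_gr[OF L X] lie_derivative_gr[OF bilinear_form X]
        lie_derivative_gr[OF bilinear_form DD(2)[OF X]]
    using form_br_even[OF x0, of X Y]
    by (cases a) (simp_all add: sq form_simps algebra_simps)
qed

end


section \<open>The double extension\<close>

context odd_symplectic_lie_superalgebra
begin

text \<open>
  The \<open>e\<^sup>*\<close>-component of the derivation rule reads \<open>- \<omega>(b0, [X, Y]) = (L\<^sub>D \<gamma>)(X, Y)\<close>, and
  \<open>L\<^sub>D \<gamma> = - \<theta>\<close>. The corrected map has degree \<open>e\<close> because \<open>\<omega>(b0, X)\<close> vanishes for even \<open>X\<close>.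
\<close>

lemma superderivation_ext_der:
  assumes D: "superderivation scl gr br e D" and b0: "b0 \<in> gr 0"
    and \<theta>: "\<And>X Y. theta_form scl gr \<omega> e D X Y = \<omega> b0 (br X Y)"
  shows "superderivation (ext_scale scl) (ext_gr gr e) (ext_br br (gamma_form scl gr \<omega> e D)) e
    (ext_der \<omega> D b0)"
proof -
  interpret E: super_vector_space "ext_scale scl" "ext_gr gr e" by (rule super_vector_space_ext)
  note DD = superderivationD[OF D]
  note L = bilinear_lie_derivative[OF bilinear_form DD(1)]
  show ?thesis
    unfolding superderivation_def
  proof (intro conjI allI ballI)
    show "Vector_Spaces.linear (ext_scale scl) (ext_scale scl) (ext_der \<omega> D b0)"
      by (auto simp: Vector_Spaces.linear_iff E.vector_space_scl ext_der_def ext_scale_Pair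
          form_simps linear_map_simps[OF DD(1)])
    fix a and U :: "'k \<times> 'v" assume U: "U \<in> ext_gr gr e a"
    obtain k X where UX: "U = (k, X)" by fastforce
    have X: "X \<in> gr a" using U by (simp add: UX ext_gr_def)
    show "ext_der \<omega> D b0 U \<in> ext_gr gr e (a + e)"
      using DD(2)[OF X] form_gr_eq_0[OF b0, of X] X
      by (cases a) (auto simp: UX ext_der_def ext_gr_def add.commute)
    fix V :: "'k \<times> 'v"
    obtain l Y where VY: "V = (l, Y)" by fastforce
    show "ext_der \<omega> D b0 (ext_br br (gamma_form scl gr \<omega> e D) U V)
      = ext_br br (gamma_form scl gr \<omega> e D) (ext_der \<omega> D b0 U) V
        + ext_scale scl (ssign (e * a)) (ext_br br (gamma_form scl gr \<omega> e D) U (ext_der \<omega> D b0 V))"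
      using \<theta>[of X Y] unfolding theta_form_eq[OF D] lie_derivative_gr[OF L X]
      by (simp add: UX VY ext_der_def ext_br_def ext_scale_Pair gamma_form_eq DD(3)[OF X] algebra_simps)
  qed
qed

lemma gamma_form_cocycle:
  assumes "superderivation scl gr br e D"
  shows "scalar_2_cocycle scl gr br (gamma_form scl gr \<omega> e D)"
    and "homogeneous_form gr (e + 1) (gamma_form scl gr \<omega> e D)"
proof -
  show "scalar_2_cocycle scl gr br (gamma_form scl gr \<omega> e D)"
    using cocycle_uminus[OF cocycle_lie_derivative[OF assms cocycle]]
    by (simp add: gamma_form_eq[abs_def])
  show "homogeneous_form gr (e + 1) (gamma_form scl gr \<omega> e D)"
    using homogeneous_lie_derivative[OF bilinear_form homogeneous_form superderivationD(2)[OF assms]]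
    by (simp add: gamma_form_eq[abs_def] homogeneous_form_def add.commute)
qed

lemma dext_gr_eq_prod: "dext_gr gr e = (\<lambda>c. ext_gr gr e c \<times> line_gr e c)"
  by (auto simp: dext_gr_def line_gr_def)

text \<open>
  The double extension is the extension of \<open>Ke\<^sup>* \<oplus> \<gg>\<close> by the corrected derivation. The two brackets
  differ in how they twist an element of \<open>Ke\<^sup>* \<oplus> \<gg>\<close>, but only in its \<open>e\<^sup>*\<close>-component, which the
  derivation kills.
\<close>

lemma dext_br_eq:
  fixes D b0 x0 e
  defines "\<gamma> \<equiv> gamma_form scl gr \<omega> e D"
  shows "dext_br scl gr br \<omega> e D x0 b0
    = derivation_ext_br (ext_scale scl) (ext_gr gr e) (ext_br br \<gamma>) e (ext_der \<omega> D b0)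
        (0, scl ((1 / 2) * (1 - ssign e)) x0)"
proof -
  interpret E: super_vector_space "ext_scale scl" "ext_gr gr e" by (rule super_vector_space_ext)
  have "snd (hcomp (ext_gr gr e) a (k, X)) = hcomp gr a X" for a and k :: 'k and X
    using E.hcomp_in[of a "(k, X)"] E.hcomp_compl[of "(k, X)" a]
    by (intro hcomp_eqI[symmetric]) (auto simp: ext_gr_def)
  moreover have "snd (ext_scale scl c U) = scl c (snd U)" for c U
    by (cases U) (simp add: ext_scale_Pair)
  ultimately have tw: "snd (twist (ext_scale scl) (ext_gr gr e) e (k, X)) = twist scl gr e X" for k :: 'k and X
    by (simp add: twist_eq E.twist_eq)
  have snd: "ext_der \<omega> D b0 U = ext_der \<omega> D b0 (0, snd U)" for U
    by (cases U) (simp add: ext_der_def)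
  have "ext_der \<omega> D b0 (twist (ext_scale scl) (ext_gr gr e) e (k, X)) = ext_der \<omega> D b0 (0, twist scl gr e X)"
    for k X
    by (subst snd) (simp only: tw)
  then show ?thesis
    by (auto simp: fun_eq_iff dext_br_def derivation_ext_br_def \<gamma>_def ext_scale_Pair)
qed

text \<open>
  For odd \<open>e\<close>, the \<open>e\<^sup>*\<close>-component of \<open>2 \<delta>\<^sup>2 X = [x0, X]\<close> reads \<open>- 2 \<omega>(b0, D X) = \<gamma>(x0, X)\<close>. As \<open>D x0 = 0\<close>,
  the right hand side is \<open>- \<omega>(x0, D X)\<close>, whence the choice \<open>b0 = x0 / 2\<close>.
\<close>

lemma lie_superalgebra_double_extension:
  assumes D: "superderivation scl gr br e D" and x0: "x0 \<in> gr 0" and b0: "b0 \<in> gr 0"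
    and \<theta>: "\<And>X Y. theta_form scl gr \<omega> e D X Y = \<omega> b0 (br X Y)"
    and odd: "e = 1 \<Longrightarrow> b0 = scl (1 / 2) x0" "e = 1 \<Longrightarrow> D x0 = 0"
      "\<And>X. e = 1 \<Longrightarrow> D (D X) = scl (1 / 2) (br x0 X)"
  shows "lie_superalgebra (dext_scale scl) (dext_gr gr e) (dext_br scl gr br \<omega> e D x0 b0)"
proof -
  let ?\<gamma> = "gamma_form scl gr \<omega> e D" and ?h0 = "(0, scl ((1 / 2) * (1 - ssign e)) x0) :: 'k \<times> 'v"
  interpret E: lie_superalgebra "ext_scale scl" "ext_gr gr e" "ext_br br ?\<gamma>"
    by (rule lie_superalgebra_central_extension[OF gamma_form_cocycle[OF D]])
  note Ds = linear_map_simps[OF superderivationD(1)[OF D]]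
  have \<gamma>0: "?\<gamma> x0 X = - \<omega> x0 (D X)" if "e = 1" for X
    unfolding gamma_form_eq lie_derivative_gr[OF bilinear_form x0] by (simp add: odd that form_simps)
  show ?thesis
    unfolding dext_scale_def dext_gr_eq_prod dext_br_eq
  proof (rule E.lie_superalgebra_derivation_extension)
    show "superderivation (ext_scale scl) (ext_gr gr e) (ext_br br ?\<gamma>) e (ext_der \<omega> D b0)"
      by (rule superderivation_ext_der[OF D b0 \<theta>])
    show "?h0 \<in> ext_gr gr e 0"
      using x0 by (simp add: ext_gr_def gr_closed)
    show "ext_der \<omega> D b0 ?h0 = 0"
      using form_gr_eq_0[OF b0 x0] odd(2) by (cases e) (auto simp: ext_der_def Ds form_simps zero_prod_def)
    show "?h0 = 0" if "e = 0" using that by (simp add: zero_prod_def)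
    show "ext_scale scl 2 (ext_der \<omega> D b0 (ext_der \<omega> D b0 U)) = ext_br br ?\<gamma> ?h0 U" if "e = 1" for U
      using \<gamma>0[OF that] odd[OF that] that
      by (cases U) (simp add: ext_der_def ext_br_def ext_scale_Pair form_simps)
  qed
qed

lemma dext_br_gr:
  assumes "superderivation scl gr br e D" and "X \<in> gr a"
  shows "dext_br scl gr br \<omega> e D x0 b0 ((k, X), s) ((l, Y), t)
    = ((- \<omega> (D X) Y - ssign (e * a) * \<omega> X (D Y) - s * \<omega> b0 Y + t * ssign (e * a) * \<omega> b0 X,
        br X Y + scl s (D Y) - scl (t * ssign (e * a)) (D X) + scl (s * t * (1 / 2 * (1 - ssign e))) x0), 0)"
  using assms(2) linear_map_simps[OF superderivationD(1)[OF assms(1)]]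
  by (simp add: dext_br_def ext_br_def ext_der_def ext_scale_Pair gamma_form_def twist_gr form_simps)

text \<open>
  Brackets have no component along \<open>e\<close>, so in the cocycle identity \<open>e\<^sup>*\<close> enters only through the
  \<open>e\<^sup>*\<close>-components of brackets, paired with \<open>e\<close>. With \<open>e\<close> in one argument, \<open>- \<gamma>(Y, Z)\<close> cancels against
  \<open>\<omega>(Y, D Z)\<close> and \<open>\<omega>(Z, D Y)\<close>; with \<open>e\<close> in two arguments, and \<open>e\<close> odd, \<open>2 \<omega>(b0, Z)\<close> cancels against
  \<open>\<omega>(Z, [e, e]) = - \<omega>(x0, Z)\<close>.
\<close>

lemma odd_symplectic_double_extension:
  assumes D: "superderivation scl gr br e D" and x0: "x0 \<in> gr 0" and b0: "b0 \<in> gr 0"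
    and L: "lie_superalgebra (dext_scale scl) (dext_gr gr e) (dext_br scl gr br \<omega> e D x0 b0)"
    and odd: "e = 1 \<Longrightarrow> b0 = scl (1 / 2) x0" "e = 1 \<Longrightarrow> D x0 = 0"
  shows "odd_symplectic_lie_superalgebra (dext_scale scl) (dext_gr gr e)
    (dext_br scl gr br \<omega> e D x0 b0) (dext_form \<omega> e)"
proof -
  let ?br = "dext_br scl gr br \<omega> e D x0 b0"
  interpret T: lie_superalgebra "dext_scale scl" "dext_gr gr e" ?br by (rule L)
  note DD = superderivationD[OF D]
  have scale: "dext_scale scl c ((k, X), s) = ((c * k, scl c X), c * s)" for c k X s
  proof -
    interpret E: super_vector_space "ext_scale scl" "ext_gr gr e" by (rule super_vector_space_ext)
    show ?thesis unfolding dext_scale_def E.line_scale_Pair by (simp add: ext_scale_Pair)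
  qed
  have form: "dext_form \<omega> e ((k, X), s) ((l, Y), t) = \<omega> X Y + k * t - s * l" for k X s l Y t
    by (cases e) (simp_all add: dext_form_def)
  have gr: "((k, X), s) \<in> dext_gr gr e c \<longleftrightarrow> X \<in> gr c \<and> (k = 0 \<or> c = e + 1) \<and> (s = 0 \<or> c = e)" for k X s c
    by (auto simp: dext_gr_def ext_gr_def)
  have antisym: "dext_form \<omega> e U V = - dext_form \<omega> e V U" for U V
  proof -
    obtain k X s l Y t where "U = ((k, X), s)" "V = ((l, Y), t)" by (metis surj_pair)
    then show ?thesis using form_antisym[of X Y] by (simp add: form)
  qed
  have bil: "bilinear_map (dext_scale scl) (*) (dext_form \<omega> e)"
    by (intro bilinear_mapI T.vector_space_scl vector_space_field)
      (auto simp: form scale form_simps algebra_simps)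
  have oddf: "dext_form \<omega> e U V = 0" if "U \<in> dext_gr gr e a" "V \<in> dext_gr gr e a" for U V a
  proof -
    obtain k X s l Y t where UV: "U = ((k, X), s)" "V = ((l, Y), t)" by (metis surj_pair)
    have "\<omega> X Y = 0" using that form_gr_eq_0 by (auto simp: UV gr)
    then show ?thesis using that unfolding UV gr form by (cases a; cases e) auto
  qed
  have coc: "ssign (c * a) * dext_form \<omega> e U (?br V W) + ssign (a * b) * dext_form \<omega> e V (?br W U)
      + ssign (b * c) * dext_form \<omega> e W (?br U V) = 0"
    if "U \<in> dext_gr gr e a" "V \<in> dext_gr gr e b" "W \<in> dext_gr gr e c" for a b c U V W
  proof -
    obtain k x s l y t m z r where UVW: "U = ((k, x), s)" "V = ((l, y), t)" "W = ((m, z), r)"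
      by (metis surj_pair)
    have x: "x \<in> gr a" "s = 0 \<or> a = e" and y: "y \<in> gr b" "t = 0 \<or> b = e" and z: "z \<in> gr c" "r = 0 \<or> c = e"
      using that by (auto simp: UVW gr)
    have anti: "\<omega> (D x) y = - \<omega> y (D x)" "\<omega> (D y) z = - \<omega> z (D y)" "\<omega> (D z) x = - \<omega> x (D z)"
      "\<omega> x x0 = - \<omega> x0 x" "\<omega> y x0 = - \<omega> x0 y" "\<omega> z x0 = - \<omega> x0 z"
      by (rule form_antisym)+
    have vanish: "b + e = a \<Longrightarrow> \<omega> x (D y) = 0" "c + e = a \<Longrightarrow> \<omega> x (D z) = 0"
      "a + e = b \<Longrightarrow> \<omega> y (D x) = 0" "c + e = b \<Longrightarrow> \<omega> y (D z) = 0"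
      "a + e = c \<Longrightarrow> \<omega> z (D x) = 0" "b + e = c \<Longrightarrow> \<omega> z (D y) = 0"
      "a = 0 \<Longrightarrow> \<omega> b0 x = 0" "b = 0 \<Longrightarrow> \<omega> b0 y = 0" "c = 0 \<Longrightarrow> \<omega> b0 z = 0"
      using DD(2)[OF x(1)] DD(2)[OF y(1)] DD(2)[OF z(1)] x(1) y(1) z(1) b0 form_gr_eq_0 by blast+
    have b0x0: "e = 1 \<Longrightarrow> \<omega> x0 u = 2 * \<omega> b0 u" for u
      by (simp add: odd form_simps)
    have "ssign (c * a) * dext_form \<omega> e U (?br V W) + ssign (a * b) * dext_form \<omega> e V (?br W U)
        + ssign (b * c) * dext_form \<omega> e W (?br U V)
      = ssign (c * a) * \<omega> x (br y z) + ssign (a * b) * \<omega> y (br z x) + ssign (b * c) * \<omega> z (br x y)"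
      unfolding UVW dext_br_gr[OF D x(1)] dext_br_gr[OF D y(1)] dext_br_gr[OF D z(1)] form
      unfolding form_simps anti
      using x(2) y(2) z(2)
      by (cases e; cases a; cases b; cases c; simp add: b0x0 vanish; simp add: algebra_simps)
    also have "\<dots> = 0" by (rule scalar_2_cocycleD(3)[OF cocycle x(1) y(1) z(1)])
    finally show ?thesis .
  qed
  have odd_form: "odd_form (dext_gr gr e) (dext_form \<omega> e)"
    using oddf by (auto simp: odd_form_def)
  then have hom: "homogeneous_form (dext_gr gr e) 1 (dext_form \<omega> e)"
    by (rule odd_form_homogeneous)
  have skew: "skew_supersymmetric (dext_gr gr e) (dext_form \<omega> e)"
    unfolding skew_supersymmetric_def
  proof (intro allI ballI)
    fix a b and U V :: "('k \<times> 'v) \<times> 'k" assume "U \<in> dext_gr gr e a" "V \<in> dext_gr gr e b"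
    then show "dext_form \<omega> e U V = - ssign (a * b) * dext_form \<omega> e V U"
      using antisym[of U V] oddf[of U a V] by (cases a; cases b) auto
  qed
  have nondeg: "U = 0" if "\<And>V. dext_form \<omega> e U V = 0" for U
  proof -
    obtain k X s where U: "U = ((k, X), s)" by (metis surj_pair)
    have "\<omega> X Y = 0" for Y using that[of "((0, Y), 0)"] by (simp add: U form)
    then have "X = 0" using nondegenerate by (auto simp: nondegenerate_form_def)
    moreover have "k = 0" using that[of "((0, 0), 1)"] by (simp add: U form form_simps)
    moreover have "s = 0" using that[of "((1, 0), 0)"] by (simp add: U form form_simps)
    ultimately show ?thesis by (simp add: U zero_prod_def)
  qed
  show ?thesis
  proof
    show "scalar_2_cocycle (dext_scale scl) (dext_gr gr e) ?br (dext_form \<omega> e)"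
      unfolding scalar_2_cocycle_def using bil hom skew coc by blast
    show "odd_form (dext_gr gr e) (dext_form \<omega> e)" by (rule odd_form)
    have "V = 0" if "\<And>U. dext_form \<omega> e U V = 0" for V
      using nondeg[of V] antisym[of V] that by simp
    then show "nondegenerate_form (dext_form \<omega> e)"
      unfolding nondegenerate_form_def using nondeg by blast
  qed
qed

end

theorem theorem3p3:
  fixes scl :: "'k::{alg_closed_field, field_char_0} \<Rightarrow> 'v::ab_group_add \<Rightarrow> 'v"
    and gr :: "bit \<Rightarrow> 'v set"
    and br :: "'v \<Rightarrow> 'v \<Rightarrow> 'v"
    and \<omega> :: "'v \<Rightarrow> 'v \<Rightarrow> 'k"
    and e :: bit
    and D :: "'v \<Rightarrow> 'v"
    and x0 :: 'v
  assumes "odd_symplectic_lie_superalgebra scl gr br \<omega>"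
    and "superderivation scl gr br e D"
    and "x0 \<in> gr 0"
    and "\<forall>X. scl (1 - ssign e) (D (D X) - scl (1 / 2) (br x0 X)) = 0"
    and "scl (1 - ssign e) (D x0) = 0"
  shows "scalar_2_cocycle scl gr br (theta_form scl gr \<omega> e D) \<and>
      (e = 1 \<longrightarrow> (\<forall>X Y. theta_form scl gr \<omega> e D X Y = \<omega> (scl (1 / 2) x0) (br X Y))) \<and>
      (\<forall>b0\<in>gr 0.
        (\<forall>X Y. theta_form scl gr \<omega> e D X Y = \<omega> b0 (br X Y)) \<and> (e = 1 \<longrightarrow> b0 = scl (1 / 2) x0) \<longrightarrow>
        lie_superalgebra (ext_scale scl) (ext_gr gr e) (ext_br br (gamma_form scl gr \<omega> e D)) \<and>
        superderivation (ext_scale scl) (ext_gr gr e) (ext_br br (gamma_form scl gr \<omega> e D)) e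
          (ext_der \<omega> D b0) \<and>
        lie_superalgebra (dext_scale scl) (dext_gr gr e) (dext_br scl gr br \<omega> e D x0 b0) \<and>
        odd_symplectic_lie_superalgebra (dext_scale scl) (dext_gr gr e)
          (dext_br scl gr br \<omega> e D x0 b0) (dext_form \<omega> e))"
proof -
  interpret odd_symplectic_lie_superalgebra scl gr br \<omega> by fact
  note D = \<open>superderivation scl gr br e D\<close> and x0 = \<open>x0 \<in> gr 0\<close>
  have nz: "(1 - ssign e :: 'k) \<noteq> 0" if "e = 1"
    using that by simp
  have sq: "D (D X) = scl (1 / 2) (br x0 X)" if "e = 1" for X
    using assms(4) nz[OF that] by simp
  have D0: "D x0 = 0" if "e = 1"
    using assms(5) nz[OF that] by simp
  have "scalar_2_cocycle scl gr br (theta_form scl gr \<omega> e D)"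
    unfolding theta_form_eq[OF D] by (intro cocycle_lie_derivative D cocycle)
  moreover have "theta_form scl gr \<omega> e D X Y = \<omega> (scl (1 / 2) x0) (br X Y)" if "e = 1" for X Y
    using theta_form_odd[of D x0] D x0 sq that by simp
  moreover have "lie_superalgebra (ext_scale scl) (ext_gr gr e) (ext_br br (gamma_form scl gr \<omega> e D))"
    by (rule lie_superalgebra_central_extension[OF gamma_form_cocycle[OF D]])
  moreover have "superderivation (ext_scale scl) (ext_gr gr e) (ext_br br (gamma_form scl gr \<omega> e D)) e
        (ext_der \<omega> D b0)"
      "lie_superalgebra (dext_scale scl) (dext_gr gr e) (dext_br scl gr br \<omega> e D x0 b0)"
      "odd_symplectic_lie_superalgebra (dext_scale scl) (dext_gr gr e)
        (dext_br scl gr br \<omega> e D x0 b0) (dext_form \<omega> e)"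
    if b0: "b0 \<in> gr 0" and \<theta>: "\<And>X Y. theta_form scl gr \<omega> e D X Y = \<omega> b0 (br X Y)"
      and odd: "e = 1 \<Longrightarrow> b0 = scl (1 / 2) x0" for b0
  proof -
    show "superderivation (ext_scale scl) (ext_gr gr e) (ext_br br (gamma_form scl gr \<omega> e D)) e
        (ext_der \<omega> D b0)"
      by (rule superderivation_ext_der[OF D b0 \<theta>])
    show L: "lie_superalgebra (dext_scale scl) (dext_gr gr e) (dext_br scl gr br \<omega> e D x0 b0)"
      by (rule lie_superalgebra_double_extension[OF D x0 b0 \<theta> odd D0 sq])
    show "odd_symplectic_lie_superalgebra (dext_scale scl) (dext_gr gr e)
        (dext_br scl gr br \<omega> e D x0 b0) (dext_form \<omega> e)"
      by (rule odd_symplectic_double_extension[OF D x0 b0 L odd D0])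
  qed
  ultimately show ?thesis by blast
qed

end
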